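(* Let $R>0$, $\alpha>2$, $P_b,P_d>0$, $\eta\in(0,1]$, $E_{th}>0$ and $p_t\in(0,1]$, and consider a D2D transmitter operating under the fixed transmission probability (FTP) scheme described in the context, with operability indicators $X_{n,o}$. Put $\mu_1=\frac{\eta P_b}{P_d\,p_t}$. Then the probability of being an operable D2D transmitter, $\pi_o^{\mathsf{FTP}}=\lim_{N\to\infty}\frac1N\sum_{n=0}^{N}\mathbb{E}[X_{n,o}]$, is $$\pi_o^{\mathsf{FTP}}=\begin{cases}\dfrac{\alpha\,\mu_1^{2/\alpha}}{(\alpha-2)R^2}+\dfrac{2\mu_1}{(2-\alpha)R^{\alpha}} & \text{if } \left(\dfrac{\eta P_b}{P_d p_t}\right)^{1/\alpha}\le R,\\[2mm] 1 & \text{if } \left(\dfrac{\eta P_b}{P_d p_t}\right)^{1/\alpha}> R.\end{cases}$$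
   Context: A base station (BS) sits at the center of a disk (cell) of radius $R$. A D2D transmitter is placed uniformly at random in the disk, so its distance $d$ to the BS has density $2r/R^2$ on $[0,R]$; $d$ is fixed over time. Time is slotted, $n=0,1,2,\dots$. In each slot the transmitter harvests energy $H_n=\eta P_b |h_n|^2 d^{-\alpha}$, where the $|h_n|^2$ are i.i.d. exponential random variables with mean $1$, independent of $d$ (Rayleigh fading; $\alpha$ is the path loss exponent, $\eta$ the conversion efficiency, $P_b$ the BS power). The battery has infinite capacity, and its energy level $E_n$ evolves by $$E_n=E_{n-1}+H_{n-1}-P_d\,X_{n-1,o}\,X_{n-1,t},$$ from a nonnegative deterministic initial level $E_0$. Here $X_{n,o}=1$ if $E_n\ge E_{th}$ and $X_{n,o}=0$ if $E_n<E_{th}$ (the transmitter is "operable" in slot $n$ when $X_{n,o}=1$), and the $X_{n,t}$ are i.i.d. Bernoulli variables with $\Pr(X_{n,t}=1)=p_t$ (FTP scheme), independent of $d$ and of the fading variables. $P_d$ is the D2D transmit power. The expectation $\mathbb{E}[X_{n,o}]$ is over all the randomness, including the location of the transmitter. *)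

theory Defs
  imports "HOL-Probability.Probability"
begin

definition harvested_energy :: "real \<Rightarrow> real \<Rightarrow> real \<Rightarrow> real \<Rightarrow> complex \<Rightarrow> real" where
  "harvested_energy \<eta> P\<^sub>b \<alpha> d h = \<eta> * P\<^sub>b * (cmod h)\<^sup>2 * d powr (- \<alpha>)"

text \<open>
  The next two functions act on a single sample path: \<open>H n\<close> is the energy harvested in slot \<open>n\<close>
  and \<open>X\<^sub>t n\<close> says whether the random access decision in slot \<open>n\<close> is to transmit. Nothing prevents
  the level from becoming negative when \<open>E\<^sub>t\<^sub>h < P\<^sub>d\<close>; the recursion is used as it stands, without
  truncation at \<open>0\<close>.
\<close>

primrec battery ::
  "real \<Rightarrow> real \<Rightarrow> real \<Rightarrow> (nat \<Rightarrow> real) \<Rightarrow> (nat \<Rightarrow> bool) \<Rightarrow> nat \<Rightarrow> real" where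
  "battery E\<^sub>0 E\<^sub>t\<^sub>h P\<^sub>d H X\<^sub>t 0 = E\<^sub>0"
| "battery E\<^sub>0 E\<^sub>t\<^sub>h P\<^sub>d H X\<^sub>t (Suc n) =
     battery E\<^sub>0 E\<^sub>t\<^sub>h P\<^sub>d H X\<^sub>t n + H n
       - P\<^sub>d * of_bool (battery E\<^sub>0 E\<^sub>t\<^sub>h P\<^sub>d H X\<^sub>t n \<ge> E\<^sub>t\<^sub>h) * of_bool (X\<^sub>t n)"

definition operable ::
  "real \<Rightarrow> real \<Rightarrow> real \<Rightarrow> (nat \<Rightarrow> real) \<Rightarrow> (nat \<Rightarrow> bool) \<Rightarrow> nat \<Rightarrow> real" where
  "operable E\<^sub>0 E\<^sub>t\<^sub>h P\<^sub>d H X\<^sub>t n = of_bool (battery E\<^sub>0 E\<^sub>t\<^sub>h P\<^sub>d H X\<^sub>t n \<ge> E\<^sub>t\<^sub>h)"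

text \<open>
  \<^const>\<open>prob_space.indep_vars\<close> needs a family with a common value type, so the distance, the fading
  gains and the transmission decisions are collected as real random variables over one index type;
  independence of this family is joint independence of all the primitive randomness.
\<close>

datatype source = Distance | Fading nat | Access nat

primrec primitive_var ::
  "('a \<Rightarrow> real) \<Rightarrow> (nat \<Rightarrow> 'a \<Rightarrow> complex) \<Rightarrow> (nat \<Rightarrow> 'a \<Rightarrow> bool) \<Rightarrow> source \<Rightarrow> 'a \<Rightarrow> real" where
  "primitive_var d h X\<^sub>t Distance = d"
| "primitive_var d h X\<^sub>t (Fading n) = (\<lambda>\<omega>. (cmod (h n \<omega>))\<^sup>2)"
| "primitive_var d h X\<^sub>t (Access n) = (\<lambda>\<omega>. of_bool (X\<^sub>t n \<omega>))"

end

theory Submission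
  imports Defs
begin

text \<open>
  Condition on the distance, so that the mean harvest per slot is a constant \<open>c\<close>; while operable, the
  transmitter spends \<open>P\<^sub>d p\<^sub>t\<close> per slot on average. The function
  \<open>m t = E (exp (t * (H - P\<^sub>d * X\<^sub>t)))\<close> satisfies \<open>m 0 = 1\<close> and has derivative \<open>c - P\<^sub>d p\<^sub>t\<close> at \<open>0\<close>.

  If \<open>c > P\<^sub>d p\<^sub>t\<close>, some \<open>t < 0\<close> has \<open>m t < 1\<close>, and \<open>E (exp (t * E\<^sub>n))\<close> decays geometrically, so that
  the probability of not being operable is summable.
  If \<open>c < P\<^sub>d p\<^sub>t\<close>, some \<open>t > 0\<close> has \<open>m t < 1\<close>, which keeps \<open>E (exp (t * E\<^sub>n))\<close>, and with it the mean
  level, bounded; energy conservation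
  \<open>E E\<^sub>N = E\<^sub>0 + N c - P\<^sub>d p\<^sub>t * (\<Sum>n<N. E X\<^sub>o n)\<close>
  then gives the average \<open>c / (P\<^sub>d p\<^sub>t)\<close>.
  The distance with \<open>c = P\<^sub>d p\<^sub>t\<close> has probability zero, and dominated convergence reduces the claim to
  integrating \<open>min 1 (\<mu>\<^sub>1 r powr (- \<alpha>))\<close> against the density \<open>2 r / R\<^sup>2\<close>.
\<close>

section \<open>Sample-path and analytic preliminaries\<close>

lemma borel_measurable_battery:
  assumes "\<And>k. k < n \<Longrightarrow> (\<lambda>x. H x k) \<in> borel_measurable N"
    and "\<And>k. k < n \<Longrightarrow> Measurable.pred N (\<lambda>x. X x k)"
  shows "(\<lambda>x. battery E\<^sub>0 E\<^sub>t\<^sub>h P\<^sub>d (H x) (X x) n) \<in> borel_measurable N"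
  using assms
proof (induction n)
  case (Suc n)
  then have [measurable]: "(\<lambda>x. battery E\<^sub>0 E\<^sub>t\<^sub>h P\<^sub>d (H x) (X x) n) \<in> borel_measurable N"
    "(\<lambda>x. H x n) \<in> borel_measurable N" "Measurable.pred N (\<lambda>x. X x n)"
    by auto
  show ?case by simp
qed simp

lemma battery_cong:
  assumes "\<And>k. k < n \<Longrightarrow> H k = H' k" "\<And>k. k < n \<Longrightarrow> X k = X' k"
  shows "battery E\<^sub>0 E\<^sub>t\<^sub>h P\<^sub>d H X n = battery E\<^sub>0 E\<^sub>t\<^sub>h P\<^sub>d H' X' n"
  using assms by (induction n) auto

text \<open>Only a slot that starts at \<open>E\<^sub>t\<^sub>h\<close> or above can lower the
  level, and by at most \<open>P\<^sub>d\<close>, so the path never falls below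
  \<open>E\<^sub>t\<^sub>h - P\<^sub>d\<close> unless it already started there.\<close>

lemma battery_lower_bound:
  assumes "\<And>k. H k \<ge> 0" "P\<^sub>d > 0"
  shows "battery E\<^sub>0 E\<^sub>t\<^sub>h P\<^sub>d H X n \<ge> min E\<^sub>0 (E\<^sub>t\<^sub>h - P\<^sub>d)"
proof (induction n)
  case (Suc n)
  then show ?case using assms(1)[of n] assms(2) by auto
qed simp

text \<open>Exponential tilting: multiplying the rate 1 density by \<open>exp (s * x)\<close> gives
  the density of rate \<open>1 - s\<close>, up to the factor \<open>1 / (1 - s)\<close>, and that
  density has total mass 1.\<close>

lemma (in prob_space) exponential_distributed_mgf:
  assumes D: "distributed M lborel G (exponential_density 1)" and s: "s < 1"
  shows "integrable M (\<lambda>\<omega>. exp (s * G \<omega>))" "expectation (\<lambda>\<omega>. exp (s * G \<omega>)) = 1 / (1 - s)"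
proof -
  interpret D': prob_space "density lborel (exponential_density (1 - s))"
    using s by (intro prob_space_exponential_density) auto
  have i0: "integrable lborel (exponential_density (1 - s))"
    "(\<integral>x. exponential_density (1 - s) x \<partial>lborel) = 1"
  proof -
    have nn: "(\<integral>\<^sup>+x. ennreal (exponential_density (1 - s) x) \<partial>lborel) = ennreal 1"
      using D'.emeasure_space_1 by (simp add: emeasure_density)
    show "integrable lborel (exponential_density (1 - s))"
      using s nn by (intro integrableI_nonneg) (auto simp: exponential_density_nonneg)
    show "(\<integral>x. exponential_density (1 - s) x \<partial>lborel) = 1"
      using s nn by (subst integral_eq_nn_integral) (auto simp: exponential_density_nonneg)
  qed
  have eq: "exponential_density 1 x * exp (s * x) = exponential_density (1 - s) x / (1 - s)" for x
    using s by (simp add: exponential_density_def exp_add[symmetric]) (simp add: algebra_simps)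
  show "integrable M (\<lambda>\<omega>. exp (s * G \<omega>))"
    by (subst distributed_integrable[OF D, symmetric, where g="\<lambda>x. exp (s * x)"])
       (auto simp: exponential_density_nonneg eq i0)
  show "expectation (\<lambda>\<omega>. exp (s * G \<omega>)) = 1 / (1 - s)"
    by (subst distributed_integral[OF D, symmetric, where g="\<lambda>x. exp (s * x)"])
       (auto simp: exponential_density_nonneg eq i0)
qed

text \<open>Here \<open>s N\<close> stands for a sum over the first \<open>N\<close> slots. The
  average in question divides \<open>N + 1\<close> terms by \<open>N\<close>; the surplus term costs
  only a further \<open>\<bar>a\<bar>\<close> in the bound.\<close>

lemma tendsto_of_bounded_defect:
  fixes s :: "nat \<Rightarrow> real"
  assumes "\<And>N. \<bar>s N - real N * a\<bar> \<le> C"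
  shows "(\<lambda>N. (1 / real N) * s (Suc N)) \<longlonglongrightarrow> a"
proof -
  have "(\<lambda>N. (1 / real N) * s (Suc N) - a) \<longlonglongrightarrow> 0"
  proof (rule Lim_null_comparison)
    show "\<forall>\<^sub>F N in sequentially. norm ((1 / real N) * s (Suc N) - a) \<le> (C + \<bar>a\<bar>) / real N"
      using eventually_gt_at_top[of 0]
    proof eventually_elim
      case (elim N)
      have "(1 / real N) * s (Suc N) - a = (s (Suc N) - real (Suc N) * a + a) / real N"
        using elim by (simp add: field_simps)
      moreover have "\<bar>s (Suc N) - real (Suc N) * a + a\<bar> \<le> C + \<bar>a\<bar>"
        using assms[of "Suc N"] by linarith
      ultimately show ?case by (simp add: divide_right_mono)
    qed
    show "(\<lambda>N. (C + \<bar>a\<bar>) / real N) \<longlonglongrightarrow> 0" by (rule lim_const_over_n)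
  qed
  then show ?thesis by (simp add: LIM_zero_iff)
qed

section \<open>The model with the distance frozen, and its independence structure\<close>

locale ftp = prob_space M for M :: "'a measure" +
  fixes d :: "'a \<Rightarrow> real" and h :: "nat \<Rightarrow> 'a \<Rightarrow> complex" and X :: "nat \<Rightarrow> 'a \<Rightarrow> bool"
    and p P E\<^sub>t\<^sub>h E\<^sub>0 :: real
  assumes fading: "\<And>n. distributed M lborel (\<lambda>\<omega>. (cmod (h n \<omega>))\<^sup>2) (exponential_density 1)"
    and access: "\<And>n. distr M (count_space UNIV) (X n) = measure_pmf (bernoulli_pmf p)"
    and indep: "indep_vars (\<lambda>_. borel) (primitive_var d h X) UNIV"
    and p: "0 < p" "p \<le> 1" and P: "P > 0"
begin

text \<open>Freezing the mean harvest at a constant \<open>c\<close> removes the distance from the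
  process. Conditioning on the location later becomes substitution of a function of \<open>d\<close>
  for \<open>c\<close>.\<close>

definition level :: "real \<Rightarrow> nat \<Rightarrow> 'a \<Rightarrow> real" where
  "level c n \<omega> = battery E\<^sub>0 E\<^sub>t\<^sub>h P (\<lambda>k. c * (cmod (h k \<omega>))\<^sup>2) (\<lambda>k. X k \<omega>) n"

lemma level_simps:
  "level c 0 \<omega> = E\<^sub>0"
  "level c (Suc n) \<omega> = level c n \<omega> + c * (cmod (h n \<omega>))\<^sup>2
     - P * of_bool (level c n \<omega> \<ge> E\<^sub>t\<^sub>h) * of_bool (X n \<omega>)"
  by (simp_all add: level_def)

lemma measurable_primitive [measurable]:
  "d \<in> borel_measurable M" "(\<lambda>\<omega>. (cmod (h n \<omega>))\<^sup>2) \<in> borel_measurable M"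
  "Measurable.pred M (X n)"
proof -
  have *: "primitive_var d h X i \<in> borel_measurable M" for i
    using indep unfolding indep_vars_def by auto
  show "d \<in> borel_measurable M" "(\<lambda>\<omega>. (cmod (h n \<omega>))\<^sup>2) \<in> borel_measurable M"
    using *[of Distance] *[of "Fading n"] by simp_all
  have [measurable]: "(\<lambda>\<omega>. of_bool (X n \<omega>) :: real) \<in> borel_measurable M"
    using *[of "Access n"] by simp
  have "Measurable.pred M (\<lambda>\<omega>. of_bool (X n \<omega>) = (1::real))"
    by measurable
  then show "Measurable.pred M (X n)" by simp
qed

lemma measurable_level [measurable]: "level c n \<in> borel_measurable M"
  unfolding level_def[abs_def] by (intro borel_measurable_battery) measurable

lemma access_mean:
  "integrable M (\<lambda>\<omega>. b (X n \<omega>) :: real)" "expectation (\<lambda>\<omega>. b (X n \<omega>)) = p * b True + (1 - p) * b False"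
proof -
  have [measurable]: "X n \<in> M \<rightarrow>\<^sub>M count_space UNIV" by measurable
  have "integrable (distr M (count_space UNIV) (X n)) b"
    unfolding access by (intro integrable_measure_pmf_finite) auto
  then show "integrable M (\<lambda>\<omega>. b (X n \<omega>))"
    by (subst (asm) integrable_distr_eq) auto
  have "expectation (\<lambda>\<omega>. b (X n \<omega>)) = integral\<^sup>L (distr M (count_space UNIV) (X n)) b"
    by (subst integral_distr) auto
  then show "expectation (\<lambda>\<omega>. b (X n \<omega>)) = p * b True + (1 - p) * b False"
    using p unfolding access by (simp add: mult.commute)
qed

text \<open>The same level as a function on the product space of source values, the form in which
  independence of disjoint blocks of sources can be applied. A decision to transmit is encoded there
  as the real value 1.\<close>

definition path_level :: "real \<Rightarrow> nat \<Rightarrow> (source \<Rightarrow> real) \<Rightarrow> real" where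
  "path_level c n y = battery E\<^sub>0 E\<^sub>t\<^sub>h P (\<lambda>k. c * y (Fading k)) (\<lambda>k. y (Access k) = 1) n"

lemma measurable_path_level:
  assumes "\<And>k. k < n \<Longrightarrow> Fading k \<in> A \<and> Access k \<in> A"
  shows "path_level c n \<in> borel_measurable (PiM A (\<lambda>_. borel))"
  unfolding path_level_def[abs_def]
proof (rule borel_measurable_battery)
  fix k assume "k < n"
  then have [measurable]: "(\<lambda>x. x (Fading k)) \<in> borel_measurable (PiM A (\<lambda>_. borel :: real measure))"
    "(\<lambda>x. x (Access k)) \<in> borel_measurable (PiM A (\<lambda>_. borel :: real measure))"
    using assms by (auto intro!: measurable_component_singleton)
  show "(\<lambda>x. c * x (Fading k)) \<in> borel_measurable (Pi\<^sub>M A (\<lambda>_. borel))"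
    by (intro borel_measurable_times borel_measurable_const) fact
  show "Measurable.pred (Pi\<^sub>M A (\<lambda>_. borel)) (\<lambda>x. x (Access k) = (1::real))"
    by (rule pred_eq_const1[where N=borel]) auto
qed

lemma path_level_restrict:
  assumes "\<And>k. k < n \<Longrightarrow> Fading k \<in> A \<and> Access k \<in> A"
  shows "path_level c n (restrict (\<lambda>i. primitive_var d h X i \<omega>) A) = level c n \<omega>"
  unfolding path_level_def level_def using assms by (intro battery_cong) auto

lemma indep_var_sources:
  assumes "A \<inter> B = {}" "f \<in> borel_measurable (PiM A (\<lambda>_. borel))" "g \<in> borel_measurable (PiM B (\<lambda>_. borel))"
  shows "indep_var borel (\<lambda>\<omega>. f (restrict (\<lambda>i. primitive_var d h X i \<omega>) A))
    borel (\<lambda>\<omega>. g (restrict (\<lambda>i. primitive_var d h X i \<omega>) B))"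
  using indep_var_compose[OF indep_var_restrict[OF indep assms(1)] assms(2,3)]
  by (simp add: comp_def)

text \<open>The level in slot \<open>n\<close> is determined by the earlier slots, hence independent
  of the gain and the decision of slot \<open>n\<close> itself. This is the one-step Markov property
  behind all the recursions below.\<close>

lemma expectation_factor:
  fixes b :: "bool \<Rightarrow> real" and u a :: "real \<Rightarrow> real"
  assumes u [measurable]: "u \<in> borel_measurable borel" and iu: "integrable M (\<lambda>\<omega>. u (level c n \<omega>))"
    and a [measurable]: "a \<in> borel_measurable borel" and ia: "integrable M (\<lambda>\<omega>. a ((cmod (h n \<omega>))\<^sup>2))"
  shows "integrable M (\<lambda>\<omega>. u (level c n \<omega>) * a ((cmod (h n \<omega>))\<^sup>2) * b (X n \<omega>))"
    "expectation (\<lambda>\<omega>. u (level c n \<omega>) * a ((cmod (h n \<omega>))\<^sup>2) * b (X n \<omega>)) =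
       expectation (\<lambda>\<omega>. u (level c n \<omega>)) * expectation (\<lambda>\<omega>. a ((cmod (h n \<omega>))\<^sup>2))
         * (p * b True + (1 - p) * b False)"
proof -
  \<comment> \<open>The sources of the slots before \<open>n\<close>. Independence is used twice:
    this block against the current gain, then the block with that gain added against the current
    decision.\<close>
  define A where "A = Fading ` {..<n} \<union> Access ` {..<n}"
  have A: "\<And>k. k < n \<Longrightarrow> Fading k \<in> A \<and> Access k \<in> A" by (auto simp: A_def)
  then have A': "\<And>k. k < n \<Longrightarrow> Fading k \<in> insert (Fading n) A \<and> Access k \<in> insert (Fading n) A" by auto
  have [measurable]: "path_level c n \<in> borel_measurable (Pi\<^sub>M A (\<lambda>_. borel))"
    "path_level c n \<in> borel_measurable (Pi\<^sub>M (insert (Fading n) A) (\<lambda>_. borel))"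
    using A by (auto intro!: measurable_path_level)
  have 1: "indep_var borel (\<lambda>\<omega>. u (level c n \<omega>)) borel (\<lambda>\<omega>. a ((cmod (h n \<omega>))\<^sup>2))"
    using indep_var_sources[of A "{Fading n}" "\<lambda>y. u (path_level c n y)" "\<lambda>y. a (y (Fading n))"]
    by (simp add: path_level_restrict[OF A]) (auto simp: A_def)
  have b_eq: "(if X n \<omega> then b True else b False) = b (X n \<omega>)" for \<omega>
    by (cases "X n \<omega>") auto
  have 2: "indep_var borel (\<lambda>\<omega>. u (level c n \<omega>) * a ((cmod (h n \<omega>))\<^sup>2)) borel (\<lambda>\<omega>. b (X n \<omega>))"
    using indep_var_sources[of "insert (Fading n) A" "{Access n}"
        "\<lambda>y. u (path_level c n y) * a (y (Fading n))" "\<lambda>y. if y (Access n) = 1 then b True else b False"]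
    by (simp add: path_level_restrict[OF A'] b_eq) (auto simp: A_def)
  note iua = indep_var_integrable[OF 1 iu ia]
  show "integrable M (\<lambda>\<omega>. u (level c n \<omega>) * a ((cmod (h n \<omega>))\<^sup>2) * b (X n \<omega>))"
    by (rule indep_var_integrable[OF 2 iua access_mean(1)])
  show "expectation (\<lambda>\<omega>. u (level c n \<omega>) * a ((cmod (h n \<omega>))\<^sup>2) * b (X n \<omega>)) =
       expectation (\<lambda>\<omega>. u (level c n \<omega>)) * expectation (\<lambda>\<omega>. a ((cmod (h n \<omega>))\<^sup>2))
         * (p * b True + (1 - p) * b False)"
    by (subst indep_var_lebesgue_integral[OF 2 iua access_mean(1)],
        subst indep_var_lebesgue_integral[OF 1 iu ia]) (simp add: access_mean)
qed

subsection \<open>Exponential moments of the battery level\<close>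

text \<open>Split according to the threshold. Below it nothing is spent; from it upwards the random
  decision contributes the factor \<open>p * exp (- t * P) + (1 - p)\<close>. The harvest
  contributes \<open>1 / (1 - t * c)\<close> in both regions, which is finite because
  \<open>t * c < 1\<close>.\<close>

lemma integrable_exp_level:
  assumes "t * c < 1"
  shows "integrable M (\<lambda>\<omega>. exp (t * level c n \<omega>))"
    and exp_level_Suc: "expectation (\<lambda>\<omega>. exp (t * level c (Suc n) \<omega>)) =
      (expectation (\<lambda>\<omega>. exp (t * level c n \<omega>) * of_bool (level c n \<omega> < E\<^sub>t\<^sub>h))
        + (p * exp (- t * P) + (1 - p)) *
          expectation (\<lambda>\<omega>. exp (t * level c n \<omega>) * of_bool (level c n \<omega> \<ge> E\<^sub>t\<^sub>h))) / (1 - t * c)"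
proof -
  define u where "u = (\<lambda>x. exp (t * x) * of_bool (x < E\<^sub>t\<^sub>h))"
  define v where "v = (\<lambda>x. exp (t * x) * of_bool (x \<ge> E\<^sub>t\<^sub>h))"
  define b where "b = (\<lambda>x. if x then exp (- t * P) else 1)"
  have [measurable]: "u \<in> borel_measurable borel" "v \<in> borel_measurable borel"
    unfolding u_def v_def by measurable
  note mgf = exponential_distributed_mgf[OF fading assms]
  \<comment> \<open>At each sample point exactly one of the two summands is nonzero.\<close>
  have split: "exp (t * level c (Suc n) \<omega>) =
      u (level c n \<omega>) * exp (t * c * (cmod (h n \<omega>))\<^sup>2) * (\<lambda>_. 1) (X n \<omega>) +
      v (level c n \<omega>) * exp (t * c * (cmod (h n \<omega>))\<^sup>2) * b (X n \<omega>)" for n \<omega>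
    by (auto simp: level_simps u_def v_def b_def exp_add[symmetric] algebra_simps)
  have uv: "integrable M (\<lambda>\<omega>. u (level c n \<omega>))" "integrable M (\<lambda>\<omega>. v (level c n \<omega>))"
    if "integrable M (\<lambda>\<omega>. exp (t * level c n \<omega>))" for n
    by (rule Bochner_Integration.integrable_bound[OF that]; auto simp: u_def v_def)+
  have int: "integrable M (\<lambda>\<omega>. exp (t * level c n \<omega>))" for n
  proof (induction n)
    case (Suc n)
    show ?case unfolding split
      by (intro Bochner_Integration.integrable_add expectation_factor uv Suc.IH mgf) measurable
  qed (simp add: level_simps)
  show "integrable M (\<lambda>\<omega>. exp (t * level c n \<omega>))" by (rule int)
  note U = expectation_factor[where u=u and c=c and n=n and a="\<lambda>x. exp (t * c * x)" and b="\<lambda>_. 1",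
      OF _ uv(1)[OF int] _ mgf(1)]
  note V = expectation_factor[where u=v and c=c and n=n and a="\<lambda>x. exp (t * c * x)" and b=b,
      OF _ uv(2)[OF int] _ mgf(1)]
  have "expectation (\<lambda>\<omega>. exp (t * level c (Suc n) \<omega>)) =
     expectation (\<lambda>\<omega>. u (level c n \<omega>)) * (1 / (1 - t * c)) * (p * 1 + (1 - p) * 1) +
     expectation (\<lambda>\<omega>. v (level c n \<omega>)) * (1 / (1 - t * c)) * (p * b True + (1 - p) * b False)"
    unfolding split using U V by (subst Bochner_Integration.integral_add) (auto simp: mgf)
  then show "expectation (\<lambda>\<omega>. exp (t * level c (Suc n) \<omega>)) =
      (expectation (\<lambda>\<omega>. exp (t * level c n \<omega>) * of_bool (level c n \<omega> < E\<^sub>t\<^sub>h))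
        + (p * exp (- t * P) + (1 - p)) *
          expectation (\<lambda>\<omega>. exp (t * level c n \<omega>) * of_bool (level c n \<omega> \<ge> E\<^sub>t\<^sub>h))) / (1 - t * c)"
    by (simp add: u_def v_def b_def add_divide_distrib mult_ac)
qed

lemma exp_level_split:
  assumes "t * c < 1"
  shows "expectation (\<lambda>\<omega>. exp (t * level c n \<omega>)) =
    expectation (\<lambda>\<omega>. exp (t * level c n \<omega>) * of_bool (level c n \<omega> < E\<^sub>t\<^sub>h)) +
    expectation (\<lambda>\<omega>. exp (t * level c n \<omega>) * of_bool (level c n \<omega> \<ge> E\<^sub>t\<^sub>h))"
proof -
  have "integrable M (\<lambda>\<omega>. exp (t * level c n \<omega>) * of_bool (level c n \<omega> < E\<^sub>t\<^sub>h))"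
    "integrable M (\<lambda>\<omega>. exp (t * level c n \<omega>) * of_bool (level c n \<omega> \<ge> E\<^sub>t\<^sub>h))"
    by (rule Bochner_Integration.integrable_bound[OF integrable_exp_level(1)[OF assms]]; auto)+
  note add = Bochner_Integration.integral_add[OF this, symmetric]
  show ?thesis
    unfolding add by (intro Bochner_Integration.integral_cong) auto
qed

section \<open>Conservation of mean energy\<close>

definition operable_prob :: "real \<Rightarrow> nat \<Rightarrow> real" where
  "operable_prob c n = expectation (\<lambda>\<omega>. of_bool (level c n \<omega> \<ge> E\<^sub>t\<^sub>h))"

lemma operable_prob_bounds: "0 \<le> operable_prob c n" "operable_prob c n \<le> 1"
proof -
  show "0 \<le> operable_prob c n" unfolding operable_prob_def by simp
  have "operable_prob c n \<le> expectation (\<lambda>_. 1)"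
    unfolding operable_prob_def
    by (intro integral_mono integrable_const_bound[where B=1]) auto
  then show "operable_prob c n \<le> 1" by (simp add: prob_space)
qed

text \<open>Take expectations in the battery recursion: the gain has mean 1, and the decision is
  independent of operability in the same slot, so the mean expenditure is a product.\<close>

lemma integrable_level: "integrable M (level c n)"
  and expectation_level_Suc:
    "expectation (level c (Suc n)) = expectation (level c n) + c - P * p * operable_prob c n"
proof -
  define u where "u = (\<lambda>x::real. of_bool (x \<ge> E\<^sub>t\<^sub>h) :: real)"
  have u [measurable]: "u \<in> borel_measurable borel" unfolding u_def by measurable
  have E: "expectation (\<lambda>\<omega>. (cmod (h n \<omega>))\<^sup>2) = 1" for n
    using exponential_distributed_expectation[OF _ fading] by simp
  \<comment> \<open>A non-integrable function has Bochner integral 0 by convention, so the value 1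
    just obtained forces integrability.\<close>
  have G: "integrable M (\<lambda>\<omega>. (cmod (h n \<omega>))\<^sup>2)" for n
    by (rule ccontr) (use E[of n] in \<open>simp add: not_integrable_integral_eq\<close>)
  have iu: "integrable M (\<lambda>\<omega>. u (level c n \<omega>))" for n
    by (rule integrable_const_bound[where B=1]) (auto simp: u_def)
  have one: "integrable M (\<lambda>\<omega>. 1 :: real)" by simp
  note F = expectation_factor[where u=u and c=c and a="\<lambda>_. 1" and b=of_bool,
      OF u iu borel_measurable_const one]
  have uX: "integrable M (\<lambda>\<omega>. u (level c n \<omega>) * of_bool (X n \<omega>))"
    "expectation (\<lambda>\<omega>. u (level c n \<omega>) * of_bool (X n \<omega>)) = p * operable_prob c n" for n
    using F[of n] by (simp_all add: operable_prob_def u_def prob_space)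
  have step: "level c (Suc n) = (\<lambda>\<omega>. level c n \<omega> + c * (cmod (h n \<omega>))\<^sup>2
      - P * (u (level c n \<omega>) * of_bool (X n \<omega>)))" for n
    by (simp add: fun_eq_iff level_simps u_def)
  have int: "integrable M (level c n)" for n
  proof (induction n)
    case 0
    have "level c 0 = (\<lambda>_. E\<^sub>0)" by (simp add: fun_eq_iff level_simps)
    then show ?case by simp
  next
    case (Suc n)
    show ?case unfolding step
      by (intro Bochner_Integration.integrable_add Bochner_Integration.integrable_diff
          integrable_mult_right Suc.IH G uX)
  qed
  show "integrable M (level c n)" by (rule int)
  have *: "integrable M (\<lambda>\<omega>. c * (cmod (h n \<omega>))\<^sup>2)" "integrable M (\<lambda>\<omega>. P * (u (level c n \<omega>) * of_bool (X n \<omega>)))"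
    by (intro integrable_mult_right G uX)+
  show "expectation (level c (Suc n)) = expectation (level c n) + c - P * p * operable_prob c n"
    unfolding step
    using int[of n] * by (simp add: uX E)
qed

text \<open>Telescoping: what has been spent is the initial charge plus the harvest minus what is
  still stored.\<close>

lemma sum_operable_prob:
  "P * p * (\<Sum>n<N. operable_prob c n) = E\<^sub>0 + N * c - expectation (level c N)"
proof (induction N)
  case 0
  have "level c 0 = (\<lambda>_. E\<^sub>0)" by (simp add: fun_eq_iff level_simps)
  then show ?case by (simp add: prob_space)
next
  case (Suc N)
  then show ?case by (simp add: expectation_level_Suc algebra_simps)
qed

text \<open>This multiplier is the moment generating function of the net gain in an operable slot.
  It equals 1 at 0, so the sign of the drift decides on which side of 0 it drops below 1.\<close>

lemma DERIV_drift_multiplier: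
  "((\<lambda>t. (p * exp (- t * P) + (1 - p)) / (1 - t * c)) has_real_derivative c - P * p) (at 0)"
  by (auto intro!: derivative_eq_intros)

text \<open>For a suitable \<open>t < 0\<close> the exponential moment contracts in both regions:
  below the threshold because pure harvesting gives the factor \<open>1 / (1 - t * c) < 1\<close>,
  above it because the drift is positive. Markov's inequality then makes a low level exponentially
  unlikely.\<close>

lemma operable_prob_supercritical:
  assumes c: "c > P * p"
  obtains K \<rho> where "0 \<le> \<rho>" "\<rho> < 1" "\<And>n. 1 - operable_prob c n \<le> K * \<rho> ^ n"
proof -
  have c0: "c > 0" using c P p by (meson less_trans mult_pos_pos)
  \<comment> \<open>The points to the left of 0 are written as \<open>-s\<close>, which flips the
    signs in the multiplier.\<close>
  obtain \<delta> where \<delta>: "\<delta> > 0" "\<And>s. 0 < s \<Longrightarrow> s < \<delta> \<Longrightarrow> (p * exp (s * P) + (1 - p)) / (1 + s * c) < 1"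
    using DERIV_pos_inc_left[OF DERIV_drift_multiplier[of c]] c by auto
  define t where "t = - \<delta> / 2"
  have t: "t < 0" "- t < \<delta>" using \<delta> by (auto simp: t_def)
  have tc: "t * c < 0" using t c0 by (simp add: mult_neg_pos)
  define r where "r = (p * exp (- t * P) + (1 - p)) / (1 - t * c)"
  \<comment> \<open>A single contraction rate serving both regions.\<close>
  define \<rho> where "\<rho> = max (1 / (1 - t * c)) r"
  have r: "r < 1" using \<delta>(2)[of "- t"] t by (simp add: r_def)
  have \<rho>: "0 \<le> \<rho>" "\<rho> < 1" using r tc by (auto simp: \<rho>_def le_max_iff_disj)
  let ?W = "\<lambda>n. expectation (\<lambda>\<omega>. exp (t * level c n \<omega>))"
  have W: "?W n \<le> exp (t * E\<^sub>0) * \<rho> ^ n" for n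
  proof (induction n)
    case (Suc n)
    let ?A = "expectation (\<lambda>\<omega>. exp (t * level c n \<omega>) * of_bool (level c n \<omega> < E\<^sub>t\<^sub>h))"
    let ?B = "expectation (\<lambda>\<omega>. exp (t * level c n \<omega>) * of_bool (level c n \<omega> \<ge> E\<^sub>t\<^sub>h))"
    have "?W (Suc n) = (1 / (1 - t * c)) * ?A + r * ?B"
      using tc by (subst exp_level_Suc) (auto simp: r_def add_divide_distrib[of ?A])
    also have "\<dots> \<le> \<rho> * ?A + \<rho> * ?B"
      by (intro add_mono mult_right_mono) (auto simp: \<rho>_def)
    also have "\<dots> = \<rho> * ?W n"
      using tc by (subst exp_level_split) (auto simp: algebra_simps)
    also have "\<dots> \<le> \<rho> * (exp (t * E\<^sub>0) * \<rho> ^ n)"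
      by (intro mult_left_mono Suc \<rho>)
    finally show ?case by (simp add: mult_ac)
  qed (simp add: level_simps prob_space)
  have "1 - operable_prob c n \<le> (exp (- t * E\<^sub>t\<^sub>h) * exp (t * E\<^sub>0)) * \<rho> ^ n" for n
  proof -
    have i: "integrable M (\<lambda>\<omega>. of_bool (level c n \<omega> \<ge> E\<^sub>t\<^sub>h) :: real)"
      by (rule integrable_const_bound[where B=1]) auto
    have "1 - operable_prob c n = expectation (\<lambda>\<omega>. 1 - of_bool (level c n \<omega> \<ge> E\<^sub>t\<^sub>h))"
      unfolding operable_prob_def using i by (subst Bochner_Integration.integral_diff) (auto simp: prob_space)
    \<comment> \<open>Exponential Markov bound: since \<open>t < 0\<close>, the integrand on the
      right is at least 1 whenever the level is below the threshold, and it is positive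
      everywhere.\<close>
    also have "\<dots> \<le> expectation (\<lambda>\<omega>. exp (- t * E\<^sub>t\<^sub>h) * exp (t * level c n \<omega>))"
      using tc t i
      by (intro integral_mono integrable_mult_right integrable_exp_level Bochner_Integration.integrable_diff)
         (auto simp: exp_add[symmetric] mult_le_cancel_left)
    also have "\<dots> = exp (- t * E\<^sub>t\<^sub>h) * ?W n" by simp
    also have "\<dots> \<le> exp (- t * E\<^sub>t\<^sub>h) * (exp (t * E\<^sub>0) * \<rho> ^ n)"
      by (intro mult_left_mono W) auto
    finally show ?thesis by (simp add: mult.assoc)
  qed
  with \<rho> show thesis by (rule that)
qed

text \<open>A Foster-Lyapunov argument with \<open>exp (t * level)\<close> for some
  \<open>t > 0\<close>: above the threshold it contracts in mean, and below the threshold it is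
  bounded anyway.\<close>

lemma expectation_level_subcritical:
  assumes c: "0 < c" "c < P * p"
  obtains K where "\<And>n. expectation (level c n) \<le> K"
proof -
  obtain \<delta> where \<delta>: "\<delta> > 0" "\<And>s. 0 < s \<Longrightarrow> s < \<delta> \<Longrightarrow> (p * exp (- s * P) + (1 - p)) / (1 - s * c) < 1"
    using DERIV_neg_dec_right[OF DERIV_drift_multiplier[of c]] c by auto
  \<comment> \<open>The minimum with \<open>1 / c\<close> keeps \<open>t * c < 1\<close>, so that
    the moment generating function of the harvest exists.\<close>
  define t where "t = min \<delta> (1 / c) / 2"
  have t: "0 < t" "t < \<delta>" and "t < 1 / c"
    using \<delta> c by (auto simp: t_def min_less_iff_disj field_simps)
  then have tc: "t * c < 1" using c by (simp add: field_simps)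
  define r where "r = (p * exp (- t * P) + (1 - p)) / (1 - t * c)"
  have r: "0 \<le> r" "r < 1" using \<delta>(2)[of t] t p tc by (auto simp: r_def)
  let ?W = "\<lambda>n. expectation (\<lambda>\<omega>. exp (t * level c n \<omega>))"
  \<comment> \<open>\<open>k\<close> bounds what the region below the threshold contributes in one
    step. \<open>K\<close> dominates both the initial value and the fixed point of
    \<open>x = k + r * x\<close>, so it is preserved by the recursion.\<close>
  define k where "k = exp (t * E\<^sub>t\<^sub>h) / (1 - t * c)"
  define K where "K = max (exp (t * E\<^sub>0)) (k / (1 - r))"
  have k: "k + r * K \<le> K"
  proof -
    have "k / (1 - r) \<le> K" by (simp add: K_def)
    then show ?thesis using r by (simp add: field_simps)
  qed
  have W: "?W n \<le> K" for n
  proof (induction n)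
    case (Suc n)
    let ?A = "expectation (\<lambda>\<omega>. exp (t * level c n \<omega>) * of_bool (level c n \<omega> < E\<^sub>t\<^sub>h))"
    let ?B = "expectation (\<lambda>\<omega>. exp (t * level c n \<omega>) * of_bool (level c n \<omega> \<ge> E\<^sub>t\<^sub>h))"
    have iA: "integrable M (\<lambda>\<omega>. exp (t * level c n \<omega>) * of_bool (level c n \<omega> < E\<^sub>t\<^sub>h))"
      by (rule Bochner_Integration.integrable_bound[OF integrable_exp_level(1)[OF tc]]; auto)
    have "?A \<le> expectation (\<lambda>_. exp (t * E\<^sub>t\<^sub>h))"
      using t by (intro integral_mono iA) auto
    then have A: "?A \<le> exp (t * E\<^sub>t\<^sub>h)" by (simp add: prob_space)
    have "0 \<le> ?A" by simp
    then have B: "?B \<le> ?W n" using exp_level_split[OF tc, of n] by linarith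
    have "?W (Suc n) = ?A / (1 - t * c) + r * ?B"
      using tc by (subst exp_level_Suc) (auto simp: r_def add_divide_distrib[of ?A])
    also have "\<dots> \<le> k + r * K"
      unfolding k_def using tc r A B Suc by (intro add_mono divide_right_mono mult_left_mono) auto
    also have "\<dots> \<le> K" by (rule k)
    finally show ?case .
  qed (simp add: level_simps prob_space K_def)
  have "expectation (level c n) \<le> K / t" for n
  proof -
    have "level c n \<omega> \<le> exp (t * level c n \<omega>) / t" for \<omega>
    proof -
      have "t * level c n \<omega> \<le> exp (t * level c n \<omega>)"
        using exp_ge_add_one_self[of "t * level c n \<omega>"] by linarith
      then show ?thesis using t by (simp add: pos_le_divide_eq mult.commute)
    qed
    then have "expectation (level c n) \<le> expectation (\<lambda>\<omega>. exp (t * level c n \<omega>) / t)"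
      by (intro integral_mono integrable_level integrable_divide integrable_exp_level tc) auto
    also have "\<dots> \<le> K / t" using W[of n] t by (simp add: divide_right_mono)
    finally show ?thesis .
  qed
  then show thesis by (rule that)
qed

text \<open>Together with the subcritical upper bound this confines the stored term of the energy
  balance.\<close>

lemma expectation_level_lower_bound:
  assumes "c \<ge> 0"
  shows "expectation (level c n) \<ge> min E\<^sub>0 (E\<^sub>t\<^sub>h - P)"
proof -
  have "expectation (\<lambda>_. min E\<^sub>0 (E\<^sub>t\<^sub>h - P)) \<le> expectation (level c n)"
    unfolding level_def[abs_def] using assms P integrable_level[of c n]
    by (intro integral_mono battery_lower_bound) (auto simp: level_def[abs_def])
  then show ?thesis by (simp add: prob_space)
qed

text \<open>In either regime the partial sums stay within a constant of linear growth: for negative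
  drift the error is the bounded mean level in the energy balance, for positive drift it is a
  geometric series of failure probabilities. At zero drift neither argument applies, hence the
  exclusion of \<open>c = P * p\<close>.\<close>

lemma operable_prob_average:
  assumes c: "0 < c" "c \<noteq> P * p"
  shows "(\<lambda>N. (1 / real N) * (\<Sum>n=0..N. operable_prob c n)) \<longlonglongrightarrow> min 1 (c / (P * p))"
proof -
  have Pp: "P * p > 0" using P p by simp
  have "\<exists>C. \<forall>N. \<bar>(\<Sum>n<N. operable_prob c n) - real N * min 1 (c / (P * p))\<bar> \<le> C"
  proof (cases "c < P * p")
    case True
    then obtain K where K: "\<And>n. expectation (level c n) \<le> K"
      using expectation_level_subcritical c by blast
    let ?C = "(\<bar>E\<^sub>0\<bar> + \<bar>K\<bar> + \<bar>min E\<^sub>0 (E\<^sub>t\<^sub>h - P)\<bar>) / (P * p)"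
    have m: "min 1 (c / (P * p)) = c / (P * p)" using True Pp by simp
    have "\<bar>(\<Sum>n<N. operable_prob c n) - real N * (c / (P * p))\<bar> \<le> ?C" for N
    proof -
      have "(\<Sum>n<N. operable_prob c n) = (E\<^sub>0 + N * c - expectation (level c N)) / (P * p)"
        using sum_operable_prob[of c N] Pp by (metis nonzero_mult_div_cancel_left less_irrefl)
      then have "(\<Sum>n<N. operable_prob c n) - real N * (c / (P * p)) = (E\<^sub>0 - expectation (level c N)) / (P * p)"
        by (simp add: diff_divide_distrib add_divide_distrib)
      moreover have "\<bar>E\<^sub>0 - expectation (level c N)\<bar> \<le> \<bar>E\<^sub>0\<bar> + \<bar>K\<bar> + \<bar>min E\<^sub>0 (E\<^sub>t\<^sub>h - P)\<bar>"
        using K[of N] expectation_level_lower_bound[of c N] c by linarith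
      ultimately show ?thesis using Pp by (simp add: abs_divide divide_right_mono del: abs_mult)
    qed
    then show ?thesis unfolding m by blast
  next
    case False
    then have c': "c > P * p" using c by simp
    then obtain K \<rho> where K: "0 \<le> \<rho>" "\<rho> < 1" "\<And>n. 1 - operable_prob c n \<le> K * \<rho> ^ n"
      using operable_prob_supercritical by blast
    have m: "min 1 (c / (P * p)) = 1" using c' Pp by simp
    have K0: "K \<ge> 0" using K(3)[of 0] operable_prob_bounds[of c 0] by simp
    have "\<bar>(\<Sum>n<N. operable_prob c n) - real N * 1\<bar> \<le> K * (1 / (1 - \<rho>))" for N
    proof -
      have "(\<Sum>n<N. operable_prob c n) - real N * 1 = - (\<Sum>n<N. 1 - operable_prob c n)"
        by (simp add: sum_subtractf)
      moreover have "0 \<le> (\<Sum>n<N. 1 - operable_prob c n)"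
        using operable_prob_bounds by (intro sum_nonneg) auto
      moreover have "(\<Sum>n<N. 1 - operable_prob c n) \<le> K * (\<Sum>n<N. \<rho> ^ n)"
        unfolding sum_distrib_left by (intro sum_mono K)
      moreover have "(\<Sum>n<N. \<rho> ^ n) \<le> 1 / (1 - \<rho>)"
        using K by (subst sum_gp_strict) (auto intro!: divide_right_mono)
      ultimately show ?thesis using mult_left_mono[of _ _ K] K0 by fastforce
    qed
    then show ?thesis unfolding m by blast
  qed
  then obtain C where "\<And>N. \<bar>(\<Sum>n<N. operable_prob c n) - real N * min 1 (c / (P * p))\<bar> \<le> C"
    by blast
  from tendsto_of_bounded_defect[OF this] show ?thesis
    by (simp add: lessThan_Suc_atMost atLeast0AtMost)
qed

subsection \<open>Averaging over the location\<close>

text \<open>Fubini in place of conditional expectation: the distance is independent of all other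
  sources, so the joint law is a product, and integrating out the other sources at a fixed distance
  \<open>r\<close> leaves \<open>operable_prob (\<phi> r) n\<close>.\<close>

lemma
  assumes [measurable]: "\<phi> \<in> borel_measurable borel"
  shows measurable_operable_prob: "(\<lambda>r. operable_prob (\<phi> r) n) \<in> borel_measurable borel"
    and expectation_operable: "expectation (\<lambda>\<omega>. of_bool (level (\<phi> (d \<omega>)) n \<omega> \<ge> E\<^sub>t\<^sub>h)) =
      expectation (\<lambda>\<omega>. operable_prob (\<phi> (d \<omega>)) n)"
proof -
  define A where "A = - {Distance}"
  define S T :: "(source \<Rightarrow> real) measure" where "S = PiM {Distance} (\<lambda>_. borel)" and "T = PiM A (\<lambda>_. borel)"
  define D Y where "D = (\<lambda>\<omega>. restrict (\<lambda>i. primitive_var d h X i \<omega>) {Distance})"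
    and "Y = (\<lambda>\<omega>. restrict (\<lambda>i. primitive_var d h X i \<omega>) A)"
  \<comment> \<open>Operability as a function of the distance and the remaining sources; its joint
    measurability is what Fubini requires.\<close>
  define f where "f = (\<lambda>(r, y). of_bool (path_level (\<phi> r) n y \<ge> E\<^sub>t\<^sub>h) :: real)"
  have A: "Fading k \<in> A \<and> Access k \<in> A" for k by (auto simp: A_def)
  have component: "(\<lambda>y. y i) \<in> borel_measurable T" if "i \<in> A" for i
    unfolding T_def by (rule measurable_component_singleton[OF that])
  have [measurable]: "(\<lambda>y. y Distance) \<in> borel_measurable S"
    unfolding S_def by (rule measurable_component_singleton) simp
  have [measurable]: "(\<lambda>z. path_level (\<phi> (fst z)) n (snd z)) \<in> borel_measurable (borel \<Otimes>\<^sub>M T)"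
    unfolding path_level_def
  proof (rule borel_measurable_battery)
    fix k
    have [measurable]: "(\<lambda>y. y (Fading k)) \<in> borel_measurable T" "(\<lambda>y. y (Access k)) \<in> borel_measurable T"
      using A by (auto intro: component)
    show "(\<lambda>x. \<phi> (fst x) * snd x (Fading k)) \<in> borel_measurable (borel \<Otimes>\<^sub>M T)"
      "Measurable.pred (borel \<Otimes>\<^sub>M T) (\<lambda>x. snd x (Access k) = 1)"
      by measurable
  qed
  have [measurable]: "f \<in> borel_measurable (borel \<Otimes>\<^sub>M T)"
    unfolding f_def split_beta' by measurable
  have "indep_var S D T Y"
    unfolding S_def T_def D_def Y_def
    by (rule indep_var_restrict[OF indep]) (auto simp: A_def)
  then have [measurable]: "D \<in> M \<rightarrow>\<^sub>M S" "Y \<in> M \<rightarrow>\<^sub>M T"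
    and joint: "distr M S D \<Otimes>\<^sub>M distr M T Y = distr M (S \<Otimes>\<^sub>M T) (\<lambda>\<omega>. (D \<omega>, Y \<omega>))"
    unfolding indep_var_distribution_eq by auto
  interpret D: prob_space "distr M S D" by (rule prob_space_distr) measurable
  interpret Y: prob_space "distr M T Y" by (rule prob_space_distr) measurable
  interpret DY: pair_prob_space "distr M S D" "distr M T Y" ..
  have q: "operable_prob (\<phi> r) n = (\<integral>y. f (r, y) \<partial>distr M T Y)" for r
  proof -
    have "operable_prob (\<phi> r) n = expectation (\<lambda>\<omega>. f (r, Y \<omega>))"
      by (simp add: operable_prob_def f_def Y_def path_level_restrict[OF A])
    also have "\<dots> = (\<integral>y. f (r, y) \<partial>distr M T Y)"
      by (rule integral_distr[symmetric]) measurable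
    finally show ?thesis .
  qed
  have "(\<lambda>r. \<integral>y. f (r, y) \<partial>distr M T Y) \<in> borel_measurable borel"
    by (rule Y.borel_measurable_lebesgue_integral) (simp add: split_beta')
  then show [measurable]: "(\<lambda>r. operable_prob (\<phi> r) n) \<in> borel_measurable borel"
    unfolding q .
  have [measurable]: "(\<lambda>z. f (fst z Distance, snd z)) \<in> borel_measurable (S \<Otimes>\<^sub>M T)"
    by measurable
  have "expectation (\<lambda>\<omega>. of_bool (level (\<phi> (d \<omega>)) n \<omega> \<ge> E\<^sub>t\<^sub>h)) =
      expectation (\<lambda>\<omega>. f (D \<omega> Distance, Y \<omega>))"
    by (simp add: f_def D_def Y_def path_level_restrict[OF A])
  also have "\<dots> = (\<integral>z. f (fst z Distance, snd z) \<partial>(distr M S D \<Otimes>\<^sub>M distr M T Y))"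
    unfolding joint by (subst integral_distr) auto
  also have "\<dots> = (\<integral>y. operable_prob (\<phi> (y Distance)) n \<partial>distr M S D)"
  proof -
    have "integrable (distr M S D \<Otimes>\<^sub>M distr M T Y) (\<lambda>z. f (fst z Distance, snd z))"
    proof (rule DY.integrable_const_bound[where B=1])
      show "AE z in distr M S D \<Otimes>\<^sub>M distr M T Y. norm (f (fst z Distance, snd z)) \<le> 1"
        by (simp add: f_def)
    qed measurable
    from DY.integral_fst'[OF this] show ?thesis by (simp add: q)
  qed
  also have "\<dots> = expectation (\<lambda>\<omega>. operable_prob (\<phi> (d \<omega>)) n)"
    by (subst integral_distr) (measurable, simp add: D_def)
  finally show "expectation (\<lambda>\<omega>. of_bool (level (\<phi> (d \<omega>)) n \<omega> \<ge> E\<^sub>t\<^sub>h)) =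
      expectation (\<lambda>\<omega>. operable_prob (\<phi> (d \<omega>)) n)" .
qed

lemma expectation_operable_average:
  assumes [measurable]: "\<phi> \<in> borel_measurable borel"
    and pos: "AE \<omega> in M. 0 < \<phi> (d \<omega>) \<and> \<phi> (d \<omega>) \<noteq> P * p"
  shows "(\<lambda>N. (1 / real N) * (\<Sum>n=0..N. expectation (\<lambda>\<omega>. of_bool (level (\<phi> (d \<omega>)) n \<omega> \<ge> E\<^sub>t\<^sub>h))))
    \<longlonglongrightarrow> expectation (\<lambda>\<omega>. min 1 (\<phi> (d \<omega>) / (P * p)))"
proof -
  note [measurable] = measurable_operable_prob[OF assms(1)]
  have int: "integrable M (\<lambda>\<omega>. operable_prob (\<phi> (d \<omega>)) n)" for n
    by (rule integrable_const_bound[where B=1]) (use operable_prob_bounds in auto)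
  have "(\<lambda>N. expectation (\<lambda>\<omega>. (1 / real N) * (\<Sum>n=0..N. operable_prob (\<phi> (d \<omega>)) n)))
    \<longlonglongrightarrow> expectation (\<lambda>\<omega>. min 1 (\<phi> (d \<omega>) / (P * p)))"
  proof (rule integral_dominated_convergence[where w="\<lambda>_. 2"])
    show "AE \<omega> in M. (\<lambda>N. (1 / real N) * (\<Sum>n=0..N. operable_prob (\<phi> (d \<omega>)) n))
        \<longlonglongrightarrow> min 1 (\<phi> (d \<omega>) / (P * p))"
      using pos by eventually_elim (rule operable_prob_average; simp)
    \<comment> \<open>The dominating constant is 2 because \<open>(N + 1) / N \<le> 2\<close> for
      \<open>N \<ge> 1\<close>; for \<open>N = 0\<close> the prefactor is 0 by the convention on
      division.\<close>
    show "AE \<omega> in M. norm ((1 / real N) * (\<Sum>n=0..N. operable_prob (\<phi> (d \<omega>)) n)) \<le> 2" for N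
    proof (rule AE_I2)
      fix \<omega>
      have "(\<Sum>n=0..N. operable_prob (\<phi> (d \<omega>)) n) \<le> (\<Sum>n=0..N. 1)"
        by (intro sum_mono operable_prob_bounds)
      then have "(\<Sum>n=0..N. operable_prob (\<phi> (d \<omega>)) n) \<le> real N + 1" by simp
      moreover have "0 \<le> (\<Sum>n=0..N. operable_prob (\<phi> (d \<omega>)) n)"
        by (intro sum_nonneg operable_prob_bounds)
      ultimately show "norm ((1 / real N) * (\<Sum>n=0..N. operable_prob (\<phi> (d \<omega>)) n)) \<le> 2"
        by (cases "N = 0") (auto simp: field_simps)
    qed
  qed auto
  then show ?thesis
    by (simp add: expectation_operable[OF assms(1)] int)
qed

end

section \<open>Law of the distance to the base station\<close>

lemma (in prob_space) distributed_dist_uniform_disk: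
  fixes Z :: "'a \<Rightarrow> real ^ 2"
  assumes Z: "distributed M lborel Z (\<lambda>z. indicator (cball bs R) z / measure lborel (cball bs R))"
    and R: "R > 0"
  shows "distributed M lborel (\<lambda>\<omega>. dist bs (Z \<omega>)) (\<lambda>r. 2 * r / R\<^sup>2 * indicator {0..R} r)"
\<comment> \<open>The distribution function is a ratio of disk areas, hence quadratic in the radius
  until it saturates at \<open>R\<close>.\<close>
proof (rule distributedI_borel_atMost[where g="\<lambda>a. if a < 0 then 0 else (min a R)\<^sup>2 / R\<^sup>2"])
  have [measurable]: "Z \<in> M \<rightarrow>\<^sub>M borel"
    using distributed_measurable[OF Z] by simp
  show "(\<lambda>\<omega>. dist bs (Z \<omega>)) \<in> borel_measurable M" by measurable
  show "(\<lambda>r. 2 * r / R\<^sup>2 * indicator {0..R} r) \<in> borel_measurable borel" by measurable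
  show "AE r in lborel. 0 \<le> 2 * r / R\<^sup>2 * indicator {0..R} r"
    by (auto simp: indicator_def)
  fix a :: real
  let ?g = "if a < 0 then 0 else (min a R)\<^sup>2 / R\<^sup>2"
  show "(\<integral>\<^sup>+ r. ennreal (2 * r / R\<^sup>2 * indicator {0..R} r * indicator {..a} r) \<partial>lborel) = ennreal ?g"
  proof (cases "a < 0")
    case True
    have "(\<integral>\<^sup>+ r. ennreal (2 * r / R\<^sup>2 * indicator {0..R} r * indicator {..a} r) \<partial>lborel) = integral\<^sup>N lborel (\<lambda>_::real. 0)"
      by (intro nn_integral_cong) (use True in \<open>auto simp: indicator_def\<close>)
    then show ?thesis using True by simp
  next
    case False
    have "(\<integral>\<^sup>+ r. ennreal (2 * r / R\<^sup>2 * indicator {0..R} r * indicator {..a} r) \<partial>lborel) =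
        (\<integral>\<^sup>+ r. ennreal (2 * r / R\<^sup>2) * indicator {0..min a R} r \<partial>lborel)"
      by (intro nn_integral_cong) (auto simp: indicator_def)
    also have "\<dots> = ennreal ((min a R)\<^sup>2 / R\<^sup>2 - 0\<^sup>2 / R\<^sup>2)"
      using False R by (intro nn_integral_FTC_Icc) (auto intro!: derivative_eq_intros simp: power2_eq_square power4_eq_xxxx)
    finally show ?thesis using False by simp
  qed
  show "emeasure M {\<omega> \<in> space M. dist bs (Z \<omega>) \<le> a} = ennreal ?g"
  proof (cases "a < 0")
    case True
    have "\<not> dist bs (Z \<omega>) \<le> a" for \<omega>
      using True zero_le_dist[of bs "Z \<omega>"] by linarith
    then have empty: "{\<omega> \<in> space M. dist bs (Z \<omega>) \<le> a} = {}" by blast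
    show ?thesis unfolding empty using True by simp
  next
    case False
    let ?V = "measure lborel (cball bs R)"
    have V: "?V > 0" using R by simp
    have "{\<omega> \<in> space M. dist bs (Z \<omega>) \<le> a} = Z -` cball bs a \<inter> space M" by auto
    then have "emeasure M {\<omega> \<in> space M. dist bs (Z \<omega>) \<le> a} =
        (\<integral>\<^sup>+ z. ennreal (indicator (cball bs R) z / ?V) * indicator (cball bs a) z \<partial>lborel)"
      using distributed_emeasure[OF Z, of "cball bs a"] by simp
    \<comment> \<open>Two concentric disks intersect in the smaller one.\<close>
    also have "\<dots> = (\<integral>\<^sup>+ z. ennreal (1 / ?V) * indicator (cball bs (min a R)) z \<partial>lborel)"
      by (intro nn_integral_cong) (auto simp: indicator_def)
    also have "\<dots> = ennreal (1 / ?V) * ennreal (measure lborel (cball bs (min a R)))"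
      using emeasure_lborel_cball_finite[of bs "min a R"]
      by (subst nn_integral_cmult_indicator) (auto simp: emeasure_eq_ennreal_measure)
    also have "\<dots> = ennreal (measure lborel (cball bs (min a R)) / ?V)"
      using V by (subst ennreal_mult[symmetric]) auto
    also have "measure lborel (cball bs (min a R)) / ?V = (min a R)\<^sup>2 / R\<^sup>2"
      using False R by (simp add: content_cball unit_ball_vol_2)
    finally show ?thesis using False by simp
  qed
qed

text \<open>A law with a Lebesgue density charges no Lebesgue null set; this is how exceptional
  distances are discarded.\<close>

lemma AE_distributed_lborel:
  assumes D: "distributed M lborel X f" and P: "AE x in lborel. P x" "Measurable.pred borel P"
  shows "AE \<omega> in M. P (X \<omega>)"
proof -
  have "AE x in density lborel f. P x"
    using P distributed_borel_measurable[OF D] by (subst AE_density) auto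
  then have "AE x in distr M lborel X. P x"
    by (simp only: distributed_distr_eq_density[OF D])
  then show ?thesis
    using P distributed_measurable[OF D] by (subst (asm) AE_distr_iff) auto
qed

section \<open>Closed form of the location average\<close>

lemma powr_threshold:
  fixes \<mu> \<alpha> r :: real
  assumes "\<mu> > 0" "\<alpha> > 0" "r > 0"
  shows "1 \<le> \<mu> * r powr (- \<alpha>) \<longleftrightarrow> r \<le> \<mu> powr (1 / \<alpha>)"
    and "\<mu> * r powr (- \<alpha>) = 1 \<longleftrightarrow> r = \<mu> powr (1 / \<alpha>)"
proof -
  define \<rho> where "\<rho> = \<mu> powr (1 / \<alpha>)"
  have \<rho>: "\<rho> > 0" "\<rho> powr \<alpha> = \<mu>" using assms by (simp_all add: \<rho>_def powr_powr)
  have "1 \<le> \<mu> * r powr (- \<alpha>) \<longleftrightarrow> r powr \<alpha> \<le> \<rho> powr \<alpha>"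
    using assms \<rho> by (simp add: powr_minus field_simps)
  also have "\<dots> \<longleftrightarrow> r \<le> \<rho>"
    using assms \<rho> powr_mono2[of \<alpha> r \<rho>] powr_less_mono2[of \<alpha> \<rho> r] by fastforce
  finally show "1 \<le> \<mu> * r powr (- \<alpha>) \<longleftrightarrow> r \<le> \<mu> powr (1 / \<alpha>)" by (simp only: \<rho>_def)
  have "\<mu> * r powr (- \<alpha>) = 1 \<longleftrightarrow> r powr \<alpha> = \<rho> powr \<alpha>"
    using assms \<rho> by (auto simp: powr_minus field_simps)
  also have "\<dots> \<longleftrightarrow> r = \<rho>"
    using assms \<rho> powr_less_mono2[of \<alpha> r \<rho>] powr_less_mono2[of \<alpha> \<rho> r] by (cases r \<rho> rule: linorder_cases) auto
  finally show "\<mu> * r powr (- \<alpha>) = 1 \<longleftrightarrow> r = \<mu> powr (1 / \<alpha>)" by (simp only: \<rho>_def)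
qed

text \<open>The minimum is 1 up to the radius \<open>\<mu> powr (1 / \<alpha>)\<close> and follows
  the path loss beyond it. If this radius exceeds \<open>R\<close>, only the total mass 1 of the
  density remains; otherwise the integral splits there.\<close>

lemma integral_truncated_path_loss:
  fixes \<mu> \<alpha> R :: real
  assumes \<mu>: "\<mu> > 0" and \<alpha>: "\<alpha> > 2" and R: "R > 0"
  shows "(\<integral>r. (2 * r / R\<^sup>2 * indicator {0..R} r) * min 1 (\<mu> * r powr (- \<alpha>)) \<partial>lborel) =
    (if \<mu> powr (1 / \<alpha>) \<le> R
     then \<alpha> * \<mu> powr (2 / \<alpha>) / ((\<alpha> - 2) * R\<^sup>2) + 2 * \<mu> / ((2 - \<alpha>) * R powr \<alpha>)
     else 1)"
proof -
  define \<rho> where "\<rho> = \<mu> powr (1 / \<alpha>)"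
  have \<rho>: "\<rho> > 0" using \<mu> by (simp add: \<rho>_def)
  have thr: "1 \<le> \<mu> * r powr (- \<alpha>) \<longleftrightarrow> r \<le> \<rho>" if "r > 0" for r
    unfolding \<rho>_def using powr_threshold \<mu> \<alpha> that by simp
  have lin: "has_bochner_integral lborel (\<lambda>r. 2 * r / R\<^sup>2 * indicator {0..b} r) (b\<^sup>2 / R\<^sup>2)" if "b > 0" for b
  proof -
    have "has_bochner_integral lborel (\<lambda>r. 2 * r / R\<^sup>2 * indicator {0..b} r) (b\<^sup>2 / R\<^sup>2 - 0\<^sup>2 / R\<^sup>2)"
      by (rule has_bochner_integral_FTC_Icc_nonneg) (use that R in \<open>auto intro!: derivative_eq_intros simp: power2_eq_square power4_eq_xxxx\<close>)
    then show ?thesis by simp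
  qed
  show ?thesis
  proof (cases "\<rho> \<le> R")
    case False
    have "(2 * r / R\<^sup>2 * indicator {0..R} r) * min 1 (\<mu> * r powr (- \<alpha>)) = 2 * r / R\<^sup>2 * indicator {0..R} r" for r
      using thr[of r] False by (cases "r > 0") (auto simp: indicator_def min_def)
    then have "(\<integral>r. (2 * r / R\<^sup>2 * indicator {0..R} r) * min 1 (\<mu> * r powr (- \<alpha>)) \<partial>lborel) = R\<^sup>2 / R\<^sup>2"
      using has_bochner_integral_integral_eq[OF lin[OF R]] by (simp only:)
    also have "\<dots> = 1" using R by simp
    finally show ?thesis using False by (simp only: \<rho>_def if_False)
  next
    case True
    let ?F = "\<lambda>r. 2 * \<mu> / R\<^sup>2 * (r powr (2 - \<alpha>) / (2 - \<alpha>))"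
    have tail: "has_bochner_integral lborel (\<lambda>r. 2 * \<mu> / R\<^sup>2 * r powr (1 - \<alpha>) * indicator {\<rho>..R} r) (?F R - ?F \<rho>)"
    proof (rule has_bochner_integral_FTC_Icc_nonneg[where F = ?F])
      fix r assume "r \<in> {\<rho>..R}"
      then have "r > 0" using \<rho> by simp
      then show "(?F has_real_derivative 2 * \<mu> / R\<^sup>2 * r powr (1 - \<alpha>)) (at r)"
        using \<alpha> R by (auto intro!: derivative_eq_intros simp: power2_eq_square power4_eq_xxxx)
    qed (use \<mu> True in auto)
    \<comment> \<open>The two closed intervals share the point \<open>\<rho>\<close>, so the
      decomposition holds only almost everywhere.\<close>
    have "AE r in lborel. (2 * r / R\<^sup>2 * indicator {0..R} r) * min 1 (\<mu> * r powr (- \<alpha>)) =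
        2 * r / R\<^sup>2 * indicator {0..\<rho>} r + 2 * \<mu> / R\<^sup>2 * r powr (1 - \<alpha>) * indicator {\<rho>..R} r"
      using AE_lborel_singleton[of \<rho>]
    proof eventually_elim
      case (elim r)
      consider "r \<le> 0" | "0 < r" "r < \<rho>" | "\<rho> < r" "r \<le> R" | "r > R" "r > \<rho>" using elim True by fastforce
      then show ?case
      proof cases
        case 3
        then have "r > 0" "\<mu> * r powr (- \<alpha>) < 1" using \<rho> thr[of r] by auto
        moreover from this have "r * r powr (- \<alpha>) = r powr (1 - \<alpha>)"
          by (simp add: powr_diff powr_minus field_simps)
        ultimately show ?thesis using 3 \<rho> by (auto simp: indicator_def min_def)
      qed (use thr[of r] \<rho> True in \<open>auto simp: indicator_def min_def\<close>)
    qed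
    then have "(\<integral>r. (2 * r / R\<^sup>2 * indicator {0..R} r) * min 1 (\<mu> * r powr (- \<alpha>)) \<partial>lborel) =
        (\<integral>r. 2 * r / R\<^sup>2 * indicator {0..\<rho>} r + 2 * \<mu> / R\<^sup>2 * r powr (1 - \<alpha>) * indicator {\<rho>..R} r \<partial>lborel)"
      by (intro integral_cong_AE) auto
    also have "\<dots> = \<rho>\<^sup>2 / R\<^sup>2 + (?F R - ?F \<rho>)"
      by (intro has_bochner_integral_integral_eq has_bochner_integral_add lin tail \<rho>)
    also have "\<dots> = \<alpha> * \<mu> powr (2 / \<alpha>) / ((\<alpha> - 2) * R\<^sup>2) + 2 * \<mu> / ((2 - \<alpha>) * R powr \<alpha>)"
    proof -
      define m where "m = \<mu> powr (2 / \<alpha>)"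
      have 1: "\<rho>\<^sup>2 = m"
        unfolding \<rho>_def m_def using \<mu> by (simp add: powr_powr flip: powr_numeral)
      \<comment> \<open>The choice of \<open>\<rho>\<close> makes the boundary term of the tail a
        multiple of the inner contribution, so both merge into the first summand of the
        formula.\<close>
      have 2: "\<mu> * \<rho> powr (2 - \<alpha>) = m"
      proof -
        have "\<rho> powr (2 - \<alpha>) = \<mu> powr (2 / \<alpha> - 1)"
          unfolding \<rho>_def using \<alpha> by (simp add: powr_powr diff_divide_distrib)
        then show ?thesis using \<mu> by (simp add: m_def powr_diff)
      qed
      have 3: "R powr (2 - \<alpha>) = R\<^sup>2 / R powr \<alpha>"
        using R by (simp add: powr_diff powr_numeral)
      have "?F \<rho> = 2 * m / (R\<^sup>2 * (2 - \<alpha>))"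
        using 2 by (simp add: field_simps)
      moreover have "?F R = 2 * \<mu> / ((2 - \<alpha>) * R powr \<alpha>)"
        unfolding 3 using R by (simp add: field_simps)
      moreover have "m / R\<^sup>2 - 2 * m / (R\<^sup>2 * (2 - \<alpha>)) = \<alpha> * m / ((\<alpha> - 2) * R\<^sup>2)"
      proof -
        have "2 * m / (R\<^sup>2 * (2 - \<alpha>)) = - (2 * m / ((\<alpha> - 2) * R\<^sup>2))"
          by (metis minus_diff_eq mult.commute mult_minus_right minus_divide_right)
        moreover have "m / R\<^sup>2 = (\<alpha> - 2) * m / ((\<alpha> - 2) * R\<^sup>2)" using \<alpha> by simp
        ultimately show ?thesis by (simp add: add_divide_distrib[symmetric] algebra_simps)
      qed
      ultimately show ?thesis unfolding 1 m_def[symmetric] by linarith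
    qed
    finally show ?thesis using True by (simp add: \<rho>_def)
  qed
qed

theorem proposition1:
  fixes M :: "'a measure"
    and R \<alpha> \<eta> P\<^sub>b P\<^sub>d E\<^sub>t\<^sub>h E\<^sub>0 p\<^sub>t \<mu>\<^sub>1 :: real
    and bs :: "real ^ 2"
    and Z :: "'a \<Rightarrow> real ^ 2"
    and d :: "'a \<Rightarrow> real"
    and h :: "nat \<Rightarrow> 'a \<Rightarrow> complex"
    and X\<^sub>t :: "nat \<Rightarrow> 'a \<Rightarrow> bool"
    and X\<^sub>o :: "nat \<Rightarrow> 'a \<Rightarrow> real"
  assumes "prob_space M"
    and "R > 0" and "\<alpha> > 2" and "P\<^sub>b > 0" and "P\<^sub>d > 0" and "0 < \<eta>" and "\<eta> \<le> 1"
    and "E\<^sub>t\<^sub>h > 0" and "E\<^sub>0 \<ge> 0" and "0 < p\<^sub>t" and "p\<^sub>t \<le> 1"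
    and location: "distributed M lborel Z
          (\<lambda>z. indicator (cball bs R) z / measure lborel (cball bs R))"
    and distance: "d = (\<lambda>\<omega>. dist bs (Z \<omega>))"
    and fading: "\<And>n. distributed M lborel (\<lambda>\<omega>. (cmod (h n \<omega>))\<^sup>2) (exponential_density 1)"
    and access: "\<And>n. distr M (count_space UNIV) (X\<^sub>t n) = measure_pmf (bernoulli_pmf p\<^sub>t)"
    and indep: "prob_space.indep_vars M (\<lambda>_. borel) (primitive_var d h X\<^sub>t) UNIV"
    and operability: "X\<^sub>o = (\<lambda>n \<omega>. operable E\<^sub>0 E\<^sub>t\<^sub>h P\<^sub>d
          (\<lambda>k. harvested_energy \<eta> P\<^sub>b \<alpha> (d \<omega>) (h k \<omega>)) (\<lambda>k. X\<^sub>t k \<omega>) n)"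
    and mu: "\<mu>\<^sub>1 = \<eta> * P\<^sub>b / (P\<^sub>d * p\<^sub>t)"
  shows "(\<lambda>N. (1 / real N) * (\<Sum>n=0..N. prob_space.expectation M (X\<^sub>o n))) \<longlonglongrightarrow>
    (if (\<eta> * P\<^sub>b / (P\<^sub>d * p\<^sub>t)) powr (1 / \<alpha>) \<le> R
     then \<alpha> * \<mu>\<^sub>1 powr (2 / \<alpha>) / ((\<alpha> - 2) * R\<^sup>2) + 2 * \<mu>\<^sub>1 / ((2 - \<alpha>) * R powr \<alpha>)
     else 1)"
proof -
  interpret prob_space M by fact
  interpret ftp M d h X\<^sub>t p\<^sub>t P\<^sub>d E\<^sub>t\<^sub>h E\<^sub>0
    by unfold_locales (use assms in auto)
  \<comment> \<open>The mean harvest per slot at distance \<open>r\<close>, as the fading gain has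
    mean 1.\<close>
  define \<phi> where "\<phi> = (\<lambda>r. \<eta> * P\<^sub>b * r powr (- \<alpha>))"
  have [measurable]: "\<phi> \<in> borel_measurable borel" unfolding \<phi>_def by measurable
  have \<mu>: "\<mu>\<^sub>1 > 0" using assms by simp
  have \<phi>_eq: "\<phi> r / (P\<^sub>d * p\<^sub>t) = \<mu>\<^sub>1 * r powr (- \<alpha>)" for r
    by (simp add: \<phi>_def mu)
  have dist: "distributed M lborel d (\<lambda>r. 2 * r / R\<^sup>2 * indicator {0..R} r)"
    unfolding distance by (rule distributed_dist_uniform_disk[OF location \<open>R > 0\<close>])
  \<comment> \<open>Two distances are excluded: the centre, where \<open>powr\<close> takes the
    value 0 and the formal harvest vanishes, and the critical distance of zero drift.\<close>
  have "AE r in lborel. r \<noteq> 0 \<and> r \<noteq> \<mu>\<^sub>1 powr (1 / \<alpha>)"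
    using AE_lborel_singleton[of 0] AE_lborel_singleton[of "\<mu>\<^sub>1 powr (1 / \<alpha>)"] by eventually_elim simp
  then have "AE \<omega> in M. d \<omega> \<noteq> 0 \<and> d \<omega> \<noteq> \<mu>\<^sub>1 powr (1 / \<alpha>)"
    by (rule AE_distributed_lborel[OF dist]) measurable
  then have "AE \<omega> in M. 0 < \<phi> (d \<omega>) \<and> \<phi> (d \<omega>) \<noteq> P\<^sub>d * p\<^sub>t"
  proof eventually_elim
    case (elim \<omega>)
    then have d: "d \<omega> > 0" by (simp add: distance)
    with elim have "\<mu>\<^sub>1 * d \<omega> powr (- \<alpha>) \<noteq> 1"
      using powr_threshold(2)[OF \<mu> _ d] \<open>\<alpha> > 2\<close> by simp
    then have "\<phi> (d \<omega>) / (P\<^sub>d * p\<^sub>t) \<noteq> 1" by (simp only: \<phi>_eq not_False_eq_True)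
    moreover have "\<phi> (d \<omega>) > 0" using d assms by (simp add: \<phi>_def)
    ultimately show ?case using assms by auto
  qed
  moreover have "X\<^sub>o = (\<lambda>n \<omega>. of_bool (level (\<phi> (d \<omega>)) n \<omega> \<ge> E\<^sub>t\<^sub>h))"
    by (simp add: operability operable_def level_def harvested_energy_def \<phi>_def mult_ac)
  ultimately have "(\<lambda>N. (1 / real N) * (\<Sum>n=0..N. expectation (X\<^sub>o n))) \<longlonglongrightarrow>
      expectation (\<lambda>\<omega>. min 1 (\<phi> (d \<omega>) / (P\<^sub>d * p\<^sub>t)))"
    using expectation_operable_average[of \<phi>] by simp
  also have "expectation (\<lambda>\<omega>. min 1 (\<phi> (d \<omega>) / (P\<^sub>d * p\<^sub>t))) =
      (\<integral>r. (2 * r / R\<^sup>2 * indicator {0..R} r) * min 1 (\<mu>\<^sub>1 * r powr (- \<alpha>)) \<partial>lborel)"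
    unfolding \<phi>_eq
    by (rule distributed_integral[OF dist, symmetric]) (auto simp: indicator_def)
  also note integral_truncated_path_loss[OF \<mu> \<open>\<alpha> > 2\<close> \<open>R > 0\<close>]
  finally show ?thesis by (simp only: mu)
qed

end
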